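(* Let $A\subset\mathbb{Z}^m$ be finite, and suppose $D\subseteq A$ is Freiman $2$-isomorphic to $S\subset\mathbb{Z}^d$. Let $S=\bigsqcup_{\theta\in\Theta}S_\theta$ be a partition with $S_\theta\neq\varnothing$ for all $\theta\in\Theta$, and suppose that it has $L^4$ decoupling constant $K$, i.e. for all $(a_x)_{x\in S}\in\mathbb{C}^S$, $$\Big\|\sum_{x\in S}a_xe(x\cdot\xi)\Big\|_{L^4(\mathbb{T}^d,\xi)}\le K\Big(\sum_{\theta\in\Theta}\Big\|\sum_{x\in S_\theta}a_xe(x\cdot\xi)\Big\|_{L^4(\mathbb{T}^d,\xi)}^2\Big)^{1/2}.$$ Then $$\sum_{\theta\in\Theta}\mathrm{Cap}_2(S_\theta)^{1/2}\le K^2|A|^{1/2}\|A\|.$$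
   Context: $e(x)=e^{2\pi i x}$, $\mathbb{T}=\mathbb{R}/\mathbb{Z}$. For a finite set $A\subset\mathbb{Z}^m$, $\|A\|:=\int_{\mathbb{T}^m}\big|\sum_{a\in A}e(a\cdot t)\big|\,dt$. Freiman $2$-isomorphic: there is a bijection $\phi:D\to S$ such that for all $d_1,\dots,d_4\in D$, $d_1+d_2=d_3+d_4$ if and only if $\phi(d_1)+\phi(d_2)=\phi(d_3)+\phi(d_4)$. For a nonempty finite set $X\subset\mathbb{Z}^d$, let $\mathcal{P}(X)$ be the set of probability measures supported on $X$; for $\mu\in\mathcal{P}(X)$ let $E_2(\mu):=\sum_{z}(\mu*\mu)(z)^2$, and define the additive capacity $\mathrm{Cap}_2(X):=\big(\inf_{\mu\in\mathcal{P}(X)}E_2(\mu)\big)^{-1}$. *)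

theory Defs
  imports "HOL-Probability.Probability"
begin

definition echar :: "real \<Rightarrow> complex" where
  "echar x = exp (2 * complex_of_real pi * \<i> * complex_of_real x)"

definition idot :: "int ^ 'n \<Rightarrow> real ^ 'n \<Rightarrow> real" where
  "idot x t = (\<Sum>i\<in>UNIV. of_int (x $ i) * t $ i)"

(* A function on the torus (R/Z)^n is given as a Z^n-periodic function on R^n.  Its integral
   against the normalised Haar measure is the Lebesgue integral over the closed unit cube, whose
   boundary is a null set. *)
definition torus_integral :: "(real ^ 'n \<Rightarrow> real) \<Rightarrow> real" where
  "torus_integral f = (LINT t:cbox 0 1|lborel. f t)"

definition L4_norm_torus :: "(real ^ 'n \<Rightarrow> complex) \<Rightarrow> real" where
  "L4_norm_torus f = root 4 (torus_integral (\<lambda>\<xi>. cmod (f \<xi>) ^ 4))"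

definition wiener_norm :: "(int ^ 'n) set \<Rightarrow> real" where
  "wiener_norm A = torus_integral (\<lambda>t. cmod (\<Sum>a\<in>A. echar (idot a t)))"

definition trig_sum :: "(int ^ 'n) set \<Rightarrow> (int ^ 'n \<Rightarrow> complex) \<Rightarrow> real ^ 'n \<Rightarrow> complex" where
  "trig_sum X a \<xi> = (\<Sum>x\<in>X. a x * echar (idot x \<xi>))"

definition freiman2_isomorphic :: "'a::plus set \<Rightarrow> 'b::plus set \<Rightarrow> bool" where
  "freiman2_isomorphic D S \<longleftrightarrow>
     (\<exists>\<phi>. bij_betw \<phi> D S \<and>
        (\<forall>d1\<in>D. \<forall>d2\<in>D. \<forall>d3\<in>D. \<forall>d4\<in>D.
           d1 + d2 = d3 + d4 \<longleftrightarrow> \<phi> d1 + \<phi> d2 = \<phi> d3 + \<phi> d4))"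

(* Convolution of probability measures: the law of the sum of two independent samples. *)
definition conv_pmf :: "'a::plus pmf \<Rightarrow> 'a pmf \<Rightarrow> 'a pmf" where
  "conv_pmf \<mu> \<nu> = map_pmf (\<lambda>(x, y). x + y) (pair_pmf \<mu> \<nu>)"

definition additive_energy :: "'a::plus pmf \<Rightarrow> real" where
  "additive_energy \<mu> = (\<Sum>\<^sub>\<infinity>z. (pmf (conv_pmf \<mu> \<mu>) z)\<^sup>2)"

definition additive_capacity :: "'a::plus set \<Rightarrow> real" where
  "additive_capacity X = inverse (INF \<mu>\<in>{\<mu>. set_pmf \<mu> \<subseteq> X}. additive_energy \<mu>)"

(* "The family of pieces has decoupling constant K" is the validity of the inequality with K;
   K is not required to be the least such constant. *)
definition L4_decoupling ::
    "(int ^ 'd) set \<Rightarrow> 'i set \<Rightarrow> ('i \<Rightarrow> (int ^ 'd) set) \<Rightarrow> real \<Rightarrow> bool" where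
  "L4_decoupling S \<Theta> P K \<longleftrightarrow>
     (\<forall>a. L4_norm_torus (trig_sum S a)
          \<le> K * sqrt (\<Sum>\<theta>\<in>\<Theta>. (L4_norm_torus (trig_sum (P \<theta>) a))\<^sup>2))"

end

theory Submission
  imports Defs
begin

text \<open>
  Pick probability measures \<open>\<mu>\<^sub>\<theta>\<close> on the pieces with energies \<open>E\<^sub>\<theta>\<close> close to the infimum, put
  \<open>c\<^sub>\<theta> = 1 / sqrt E\<^sub>\<theta>\<close> and \<open>w = (\<Sum>\<theta>. c\<^sub>\<theta> \<mu>\<^sub>\<theta>)\<close>, and transport \<open>w\<close> to \<open>D\<close> along the Freiman isomorphism.
  Let \<open>F\<close> be the exponential sum of \<open>A\<close> and \<open>G\<close> that of the transported weight. By orthogonality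
  \<open>T = (\<Sum>\<theta>. c\<^sub>\<theta>)\<close> is the pairing of \<open>F\<close> with \<open>G\<close>, and two applications of Cauchy-Schwarz bound it by
  \<open>\<parallel>F\<parallel>\<^sub>1 ^ (1/2) * \<parallel>F\<parallel>\<^sub>2 ^ (1/2) * \<parallel>G\<parallel>\<^sub>4\<close>. The fourth power of \<open>\<parallel>G\<parallel>\<^sub>4\<close> is an additive energy, hence invariant under
  Freiman isomorphism, so decoupling on \<open>S\<close> gives \<open>\<parallel>G\<parallel>\<^sub>4 \<le> K * sqrt (\<Sum>\<theta>. c\<^sub>\<theta>\<^sup>2 * sqrt E\<^sub>\<theta>) = K * sqrt T\<close>;
  this choice of \<open>c\<^sub>\<theta>\<close> lets one cancel \<open>T\<close>.
\<close>

section \<open>Characters and their orthogonality on the unit cube\<close>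

text \<open>Fubini for functions that split over the coordinates: \<open>lborel\<close> is the image
  of the product of one-dimensional Lebesgue measures under the coordinate map.\<close>

lemma integral_lborel_prod:
  fixes f :: "'a::euclidean_space \<Rightarrow> real \<Rightarrow> 'b::{real_normed_field,banach,second_countable_topology}"
  assumes int: "\<And>b. b \<in> Basis \<Longrightarrow> integrable lborel (f b)"
  shows "(\<integral>x. (\<Prod>b\<in>Basis. f b (x \<bullet> b)) \<partial>lborel) = (\<Prod>b\<in>Basis. \<integral>s. f b s \<partial>lborel)"
proof -
  interpret product_sigma_finite "\<lambda>_::'a. lborel :: real measure"
    by standard
  have meas: "(\<lambda>x::'a. \<Prod>b\<in>Basis. f b (x \<bullet> b)) \<in> borel_measurable borel"
  proof (rule borel_measurable_prod)
    fix b :: 'a assume "b \<in> Basis"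
    then have "f b \<in> borel_measurable borel"
      using int borel_measurable_integrable by fastforce
    then show "(\<lambda>x. f b (x \<bullet> b)) \<in> borel_measurable borel"
      by (rule measurable_compose[rotated]) simp
  qed
  have "(\<integral>x. (\<Prod>b\<in>Basis. f b (x \<bullet> b)) \<partial>lborel)
      = (\<integral>g. (\<Prod>b\<in>Basis. f b ((\<Sum>b\<in>Basis. g b *\<^sub>R b) \<bullet> b)) \<partial>(\<Pi>\<^sub>M b\<in>(Basis::'a set). lborel))"
    by (subst lborel_eq, subst integral_distr) (use meas in auto)
  also have "\<dots> = (\<integral>g. (\<Prod>b\<in>Basis. f b (g b)) \<partial>(\<Pi>\<^sub>M b\<in>(Basis::'a set). lborel))"
    by (intro Bochner_Integration.integral_cong prod.cong refl) (simp add: inner_sum_left_Basis)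
  also have "\<dots> = (\<Prod>b\<in>Basis. \<integral>s. f b s \<partial>lborel)"
    by (rule product_integral_prod) (use int in auto)
  finally show ?thesis .
qed

lemma echar_add: "echar (x + y) = echar x * echar y"
  by (simp add: echar_def distrib_left exp_add)

lemma echar_sum: "finite I \<Longrightarrow> echar (\<Sum>i\<in>I. f i) = (\<Prod>i\<in>I. echar (f i))"
  by (simp add: echar_def sum_distrib_left exp_sum)

lemma echar_0 [simp]: "echar 0 = 1"
  by (simp add: echar_def)

lemma cnj_echar: "cnj (echar x) = echar (- x)"
  by (simp add: echar_def exp_cnj)

lemma continuous_on_echar [continuous_intros]:
  "continuous_on S f \<Longrightarrow> continuous_on S (\<lambda>x. echar (f x))"
  unfolding echar_def by (intro continuous_intros)

lemma echar_of_int: "echar (of_int n) = 1"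
  unfolding echar_def exp_eq_1 by auto

text \<open>For \<open>n \<noteq> 0\<close> the antiderivative \<open>exp (?c * s) / ?c\<close>
  takes the same value at both endpoints, because \<open>echar\<close> is 1 at integers.\<close>

lemma integral_unit_interval_echar:
  "(\<integral>s. indicator {0..1} s *\<^sub>R echar (of_int n * s) \<partial>lborel) = of_bool (n = 0)"
proof (cases "n = 0")
  case False
  let ?c = "2 * complex_of_real pi * \<i> * of_int n"
  have c: "?c \<noteq> 0" using False by simp
  have "((\<lambda>s. exp (?c * of_real s) / ?c) has_vector_derivative echar (of_int n * s)) (at s within {0..1})" for s
  proof -
    have "((\<lambda>z. exp (?c * z) / ?c) has_field_derivative exp (?c * of_real s)) (at (of_real s))"
      using c by (auto intro!: derivative_eq_intros)
    then have "((\<lambda>s. exp (?c * of_real s) / ?c) has_vector_derivative exp (?c * of_real s)) (at s within {0..1})"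
      by (intro has_vector_derivative_real_field) (auto intro: has_field_derivative_at_within)
    then show ?thesis by (simp add: echar_def mult_ac)
  qed
  then have "(\<integral>s. indicator {0..1} s *\<^sub>R echar (of_int n * s) \<partial>lborel)
      = exp (?c * of_real 1) / ?c - exp (?c * of_real 0) / ?c"
    by (intro integral_FTC_atLeastAtMost) (auto intro!: continuous_intros)
  also have "\<dots> = 0"
    using echar_of_int[of n] by (simp add: echar_def mult_ac)
  finally show ?thesis using False by simp
qed simp

lemma idot_add_left: "idot (x + y) t = idot x t + idot y t"
  by (simp add: idot_def distrib_right sum.distrib)

lemma idot_diff_left: "idot (x - y) t = idot x t - idot y t"
  by (simp add: idot_def left_diff_distrib sum_subtractf)

lemma continuous_on_idot [continuous_intros]: "continuous_on S (idot x)"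
  unfolding idot_def by (intro continuous_intros)

lemma integrable_unit_cube:
  fixes f :: "real ^ 'n \<Rightarrow> 'b::{banach, second_countable_topology}"
  assumes "continuous_on UNIV f"
  shows "integrable lborel (\<lambda>t. indicator (cbox 0 1) t *\<^sub>R f t)"
  using assms by (intro borel_integrable_compact) (auto intro: continuous_on_subset)

text \<open>Orthogonality of characters. The indicator of the cube and the character both split over
  the coordinates, so the integral is a product of one-dimensional ones, and a single nonzero
  frequency makes it vanish.\<close>

lemma integral_unit_cube_echar:
  fixes x :: "int ^ 'n"
  shows "(\<integral>t. indicator (cbox 0 1) t *\<^sub>R echar (idot x t) \<partial>lborel) = of_bool (x = 0)"
proof -
  \<comment> \<open>The real copy of \<open>x\<close> turns \<open>idot\<close> into an inner
    product, so that the coordinates are indexed by \<open>Basis\<close> as in the Fubini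
    lemma.\<close>
  define y :: "real ^ 'n" where "y = (\<chi> i. of_int (x $ i))"
  have idot: "idot x t = (\<Sum>b\<in>Basis. (y \<bullet> b) * (t \<bullet> b))" for t
    unfolding euclidean_inner[symmetric] by (simp add: idot_def y_def inner_vec_def)
  have y_int: "\<exists>n. y \<bullet> b = of_int n" if "b \<in> Basis" for b
    using that by (auto simp: Basis_vec_def inner_axis y_def)
  have y0: "x = 0 \<longleftrightarrow> (\<forall>b\<in>Basis. y \<bullet> b = 0)"
    by (subst euclidean_all_zero_iff) (simp add: y_def vec_eq_iff)
  have one: "(1::real^'n) \<bullet> b = 1" if "b \<in> Basis" for b
    using that by (auto simp: Basis_vec_def inner_axis)
  let ?f = "\<lambda>b s. indicator {0..1} s *\<^sub>R echar ((y \<bullet> b) * s)"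
  have ind: "indicator (cbox 0 1) t = (\<Prod>b\<in>Basis. indicator {0..1} (t \<bullet> b) :: real)" for t :: "real^'n"
    by (auto simp: indicator_def mem_box one prod_eq_1_iff intro!: prod_zero)
  have "indicator (cbox 0 1) t *\<^sub>R echar (idot x t) = (\<Prod>b\<in>Basis. ?f b (t \<bullet> b))" for t
    by (simp add: idot echar_sum ind scaleR_conv_of_real prod.distrib)
  then have "(\<integral>t. indicator (cbox 0 1) t *\<^sub>R echar (idot x t) \<partial>lborel)
      = (\<integral>t. (\<Prod>b\<in>Basis. ?f b (t \<bullet> b)) \<partial>(lborel :: (real^'n) measure))"
    by simp
  also have "\<dots> = (\<Prod>b\<in>Basis. \<integral>s. ?f b s \<partial>lborel)"
    by (rule integral_lborel_prod) (intro borel_integrable_compact continuous_intros; simp)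
  also have "\<dots> = (\<Prod>b\<in>Basis. of_bool (y \<bullet> b = 0))"
  proof (rule prod.cong)
    fix b :: "real^'n" assume "b \<in> Basis"
    then obtain n where "y \<bullet> b = of_int n" using y_int by blast
    then show "(\<integral>s. ?f b s \<partial>lborel) = of_bool (y \<bullet> b = 0)"
      using integral_unit_interval_echar[of n] by simp
  qed simp
  also have "\<dots> = of_bool (x = 0)"
    unfolding y0 by (auto intro!: prod_zero)
  finally show ?thesis .
qed

text \<open>Only zero frequencies survive integration. The family \<open>k\<close> may repeat
  values, so an expanded product of exponential sums can be integrated without first collecting
  equal frequencies.\<close>

lemma torus_integral_Re_trig:
  fixes k :: "'i \<Rightarrow> int ^ 'n" and c :: "'i \<Rightarrow> real"
  assumes "finite I"
    and f: "\<And>t. f t = Re (\<Sum>i\<in>I. of_real (c i) * echar (idot (k i) t))"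
  shows "torus_integral f = (\<Sum>i\<in>I. c i * of_bool (k i = 0))"
proof -
  let ?g = "\<lambda>i t. indicator (cbox 0 1) t *\<^sub>R echar (idot (k i) t) :: complex"
  have int: "integrable lborel (?g i)" for i
    by (intro integrable_unit_cube continuous_intros)
  have "torus_integral f = (\<integral>t. Re (\<Sum>i\<in>I. of_real (c i) * ?g i t) \<partial>lborel)"
    unfolding torus_integral_def set_lebesgue_integral_def f
    by (intro Bochner_Integration.integral_cong) (auto simp: sum_distrib_left)
  also have "\<dots> = Re (\<integral>t. (\<Sum>i\<in>I. of_real (c i) * ?g i t) \<partial>lborel)"
    by (rule integral_Re) (intro Bochner_Integration.integrable_sum integrable_mult_right int)
  also have "\<dots> = Re (\<Sum>i\<in>I. \<integral>t. of_real (c i) * ?g i t \<partial>lborel)"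
    by (subst Bochner_Integration.integral_sum) (intro integrable_mult_right int refl)+
  also have "\<dots> = Re (\<Sum>i\<in>I. of_real (c i * of_bool (k i = 0)))"
    by (simp only: integral_mult_right_zero integral_unit_cube_echar of_real_mult of_bool_def if_distrib[of complex_of_real] of_real_0 of_real_1)
  also have "\<dots> = (\<Sum>i\<in>I. c i * of_bool (k i = 0))"
    by (simp only: of_real_sum[symmetric] Re_complex_of_real)
  finally show ?thesis .
qed

section \<open>Inequalities for torus integrals\<close>

lemma torus_integral_nonneg: "(\<And>t. 0 \<le> f t) \<Longrightarrow> 0 \<le> torus_integral f"
  unfolding torus_integral_def set_lebesgue_integral_def
  by (intro Bochner_Integration.integral_nonneg) auto

lemma torus_integral_mono:
  assumes "continuous_on UNIV f" "continuous_on UNIV g" "\<And>t. f t \<le> g t"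
  shows "torus_integral f \<le> torus_integral g"
  unfolding torus_integral_def set_lebesgue_integral_def
  using assms by (intro integral_mono integrable_unit_cube) (auto simp: indicator_def)

text \<open>The integral of \<open>(f t * u + g t * v)\<^sup>2\<close> is a nonnegative quadratic
  form in \<open>u\<close> and \<open>v\<close>; suitable values of these bound its
  discriminant.\<close>

lemma torus_integral_Cauchy_Schwarz:
  fixes f g :: "real ^ 'n \<Rightarrow> real"
  assumes f: "continuous_on UNIV f" and g: "continuous_on UNIV g"
  shows "(torus_integral (\<lambda>t. f t * g t))\<^sup>2
       \<le> torus_integral (\<lambda>t. (f t)\<^sup>2) * torus_integral (\<lambda>t. (g t)\<^sup>2)"
proof -
  let ?I = "indicator (cbox 0 1) :: real ^ 'n \<Rightarrow> real"
  define a b c where "a = torus_integral (\<lambda>t. (f t)\<^sup>2)"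
    and "b = torus_integral (\<lambda>t. f t * g t)" and "c = torus_integral (\<lambda>t. (g t)\<^sup>2)"
  have int: "integrable lborel (\<lambda>t. ?I t *\<^sub>R (f t)\<^sup>2)" "integrable lborel (\<lambda>t. ?I t *\<^sub>R (f t * g t))"
    "integrable lborel (\<lambda>t. ?I t *\<^sub>R (g t)\<^sup>2)"
    by (intro integrable_unit_cube continuous_intros f g)+
  have quad: "0 \<le> a * u\<^sup>2 + 2 * b * u * v + c * v\<^sup>2" for u v
  proof -
    have "0 \<le> torus_integral (\<lambda>t. (f t * u + g t * v)\<^sup>2)"
      by (rule torus_integral_nonneg) simp
    also have "\<dots> = (\<integral>t. (u\<^sup>2 * (?I t *\<^sub>R (f t)\<^sup>2) + (2 * u * v) * (?I t *\<^sub>R (f t * g t)))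
        + v\<^sup>2 * (?I t *\<^sub>R (g t)\<^sup>2) \<partial>lborel)"
      unfolding torus_integral_def set_lebesgue_integral_def
      by (intro Bochner_Integration.integral_cong) (auto simp: power2_eq_square algebra_simps)
    also have "\<dots> = a * u\<^sup>2 + 2 * b * u * v + c * v\<^sup>2"
      using int by (subst Bochner_Integration.integral_add, simp, simp)+
        (simp add: a_def b_def c_def torus_integral_def set_lebesgue_integral_def)
    finally show ?thesis .
  qed
  have "a \<ge> 0" unfolding a_def by (rule torus_integral_nonneg) simp
  show ?thesis
  proof (cases "a = 0")
    case True
    have "b = 0"
    proof (rule ccontr)
      assume "b \<noteq> 0"
      \<comment> \<open>With \<open>a = 0\<close> the form at this point equals
        \<open>- (c + 1) + c = - 1\<close>.\<close>
      with quad[of "- (c + 1) / (2 * b)" 1] show False using True by simp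
    qed
    then show ?thesis using True by (simp flip: a_def b_def c_def)
  next
    case False
    \<comment> \<open>At \<open>u = - b\<close>, \<open>v = a\<close> the form factors as shown,
      which avoids a division by \<open>a\<close>.\<close>
    have "0 \<le> a * (a * c - b\<^sup>2)"
      using quad[of "- b" a] by (simp add: power2_eq_square algebra_simps)
    then have "b\<^sup>2 \<le> a * c"
      using False \<open>a \<ge> 0\<close> by (simp add: zero_le_mult_iff)
    then show ?thesis by (simp flip: a_def b_def c_def)
  qed
qed

section \<open>Additive energy of finite weights\<close>

text \<open>The weighted count of additive quadruples in \<open>X\<close>. Weights need not have
  total mass 1, so rescaled and glued measures are covered; the grouping into pairs matches the
  expansion of a squared exponential sum.\<close>

definition weighted_energy :: "'a::plus set \<Rightarrow> ('a \<Rightarrow> real) \<Rightarrow> real" where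
  "weighted_energy X w =
     (\<Sum>p\<in>X \<times> X. \<Sum>q\<in>X \<times> X. w (fst p) * w (snd p) * (w (fst q) * w (snd q))
        * of_bool (fst p + snd p = fst q + snd q))"

lemma weighted_energy_cong:
  assumes "\<And>x. x \<in> X \<Longrightarrow> v x = w x"
  shows "weighted_energy X v = weighted_energy X w"
  unfolding weighted_energy_def using assms by (intro sum.cong refl) auto

lemma weighted_energy_scale:
  "weighted_energy X (\<lambda>x. c * w x) = c ^ 4 * weighted_energy X w"
  unfolding weighted_energy_def sum_distrib_left
  by (intro sum.cong refl) (simp add: power4_eq_xxxx mult_ac)

text \<open>The energy sees the group structure only through coincidences between sums of two
  elements, which are exactly what \<phi> preserves and reflects.\<close>

lemma weighted_energy_freiman2_isomorphism:
  assumes bij: "bij_betw \<phi> D S"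
    and iso: "\<And>d1 d2 d3 d4. d1 \<in> D \<Longrightarrow> d2 \<in> D \<Longrightarrow> d3 \<in> D \<Longrightarrow> d4 \<in> D \<Longrightarrow>
           d1 + d2 = d3 + d4 \<longleftrightarrow> \<phi> d1 + \<phi> d2 = \<phi> d3 + \<phi> d4"
  shows "weighted_energy D (\<lambda>d. w (\<phi> d)) = weighted_energy S w"
proof -
  have bij2: "bij_betw (map_prod \<phi> \<phi>) (D \<times> D) (S \<times> S)"
    using bij bij by (rule bij_betw_map_prod)
  show ?thesis
    unfolding weighted_energy_def sum.reindex_bij_betw[OF bij2, symmetric]
    using iso by (intro sum.cong refl) (auto simp: of_bool_def)
qed

lemma pmf_conv_pmf_finite:
  assumes "finite X" "set_pmf \<mu> \<subseteq> X"
  shows "pmf (conv_pmf \<mu> \<mu>) z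
       = (\<Sum>p\<in>X \<times> X. pmf \<mu> (fst p) * pmf \<mu> (snd p) * of_bool (fst p + snd p = z))"
proof -
  let ?B = "(\<lambda>(x, y). x + y) -` {z}"
  have "pmf (conv_pmf \<mu> \<mu>) z = measure (pair_pmf \<mu> \<mu>) ?B"
    unfolding conv_pmf_def by (rule pmf_map)
  also have "\<dots> = (\<integral>p. indicator ?B p \<partial>pair_pmf \<mu> \<mu>)"
    by simp
  also have "\<dots> = (\<Sum>p\<in>X \<times> X. indicator ?B p * pmf (pair_pmf \<mu> \<mu>) p)"
    by (rule integral_measure_pmf_real) (use assms in auto)
  also have "\<dots> = (\<Sum>p\<in>X \<times> X. pmf \<mu> (fst p) * pmf \<mu> (snd p) * of_bool (fst p + snd p = z))"
    by (intro sum.cong refl) (auto simp: pmf_pair indicator_def)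
  finally show ?thesis .
qed

text \<open>Squaring the convolution at \<open>z\<close> counts two pairs that both have sum
  \<open>z\<close>; summing over \<open>z\<close> leaves the pairs of pairs with equal sums.\<close>

lemma additive_energy_eq_weighted_energy:
  assumes fin: "finite X" and sub: "set_pmf \<mu> \<subseteq> X"
  shows "additive_energy \<mu> = weighted_energy X (pmf \<mu>)"
proof -
  define s where "s = (\<lambda>p::'a \<times> 'a. fst p + snd p)"
  define u where "u = (\<lambda>p. pmf \<mu> (fst p) * pmf \<mu> (snd p))"
  define Z where "Z = s ` (X \<times> X)"
  have conv: "pmf (conv_pmf \<mu> \<mu>) z = (\<Sum>p\<in>X \<times> X. u p * of_bool (s p = z))" for z
    using pmf_conv_pmf_finite[OF fin sub] by (simp add: s_def u_def)
  have "finite Z" using fin by (simp add: Z_def)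
  have "additive_energy \<mu> = (\<Sum>\<^sub>\<infinity>z\<in>Z. (pmf (conv_pmf \<mu> \<mu>) z)\<^sup>2)"
    unfolding additive_energy_def
    \<comment> \<open>The convolution vanishes off the sumset \<open>Z\<close>, so the infinite sum
      becomes a finite one.\<close>
    by (rule infsum_cong_neutral) (auto simp: conv Z_def intro!: sum.neutral)
  also have "\<dots> = (\<Sum>z\<in>Z. (\<Sum>p\<in>X \<times> X. u p * of_bool (s p = z))\<^sup>2)"
    using \<open>finite Z\<close> by (simp add: conv)
  \<comment> \<open>Given \<open>s p = z\<close>, the condition \<open>s q = z\<close> becomes
    \<open>s p = s q\<close>; then \<open>z\<close> occurs in one factor only and can be summed
    out.\<close>
  also have "\<dots> = (\<Sum>z\<in>Z. \<Sum>p\<in>X \<times> X. \<Sum>q\<in>X \<times> X. u p * u q * of_bool (s p = s q) * of_bool (s p = z))"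
    unfolding power2_eq_square sum_product by (intro sum.cong refl) auto
  also have "\<dots> = (\<Sum>p\<in>X \<times> X. \<Sum>q\<in>X \<times> X. \<Sum>z\<in>Z. u p * u q * of_bool (s p = s q) * of_bool (s p = z))"
    by (subst sum.swap) (intro sum.cong refl sum.swap)
  also have "\<dots> = (\<Sum>p\<in>X \<times> X. \<Sum>q\<in>X \<times> X. u p * u q * of_bool (s p = s q))"
  proof (intro sum.cong refl)
    fix p q assume "p \<in> X \<times> X"
    then have "s p \<in> Z" unfolding Z_def by blast
    then show "(\<Sum>z\<in>Z. u p * u q * of_bool (s p = s q) * of_bool (s p = z)) = u p * u q * of_bool (s p = s q)"
      using \<open>finite Z\<close> by (subst sum_distrib_left[symmetric]) (simp add: of_bool_def sum.delta')
  qed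
  finally show ?thesis by (simp add: weighted_energy_def s_def u_def)
qed

lemma additive_energy_nonneg: "0 \<le> additive_energy \<mu>"
  unfolding additive_energy_def by (rule infsum_nonneg) simp

section \<open>Exponential sums: fourth moments and duality\<close>

lemma continuous_on_trig_sum [continuous_intros]: "continuous_on T (trig_sum X a)"
  unfolding trig_sum_def by (intro continuous_intros)

lemma L4_norm_torus_nonneg: "0 \<le> L4_norm_torus f"
  unfolding L4_norm_torus_def by (intro real_root_ge_zero torus_integral_nonneg) simp

lemma L4_norm_torus_power4: "L4_norm_torus f ^ 4 = torus_integral (\<lambda>\<xi>. cmod (f \<xi>) ^ 4)"
  unfolding L4_norm_torus_def by (intro real_root_pow_pos2 torus_integral_nonneg) auto

lemma trig_sum_power2:
  "(trig_sum X a t)\<^sup>2 = (\<Sum>p\<in>X \<times> X. a (fst p) * a (snd p) * echar (idot (fst p + snd p) t))"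
  unfolding trig_sum_def power2_eq_square sum_product sum.cartesian_product
  by (intro sum.cong refl) (auto simp: idot_add_left echar_add)

text \<open>Expanding the fourth power of the modulus as
  \<open>(?G t)\<^sup>2 * cnj ((?G t)\<^sup>2)\<close> gives the frequencies
  \<open>(fst p + snd p) - (fst q + snd q)\<close>, and those that vanish are the additive
  quadruples.\<close>

lemma L4_norm_trig_sum_power4:
  assumes "finite X"
  shows "L4_norm_torus (trig_sum X (\<lambda>x. of_real (w x))) ^ 4 = weighted_energy X w"
proof -
  let ?I = "(X \<times> X) \<times> (X \<times> X)"
  let ?c = "\<lambda>(p, q). w (fst p) * w (snd p) * (w (fst q) * w (snd q))"
  let ?k = "\<lambda>(p, q). (fst p + snd p) - (fst q + snd q)"
  let ?G = "trig_sum X (\<lambda>x. of_real (w x))"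
  have "cmod (?G t) ^ 4 = Re (\<Sum>i\<in>?I. of_real (?c i) * echar (idot (?k i) t))" for t
  proof -
    have "complex_of_real (cmod (?G t) ^ 4) = (of_real ((cmod (?G t))\<^sup>2))\<^sup>2"
      by (simp flip: power_mult)
    also have "\<dots> = (?G t)\<^sup>2 * cnj ((?G t)\<^sup>2)"
      by (simp only: complex_norm_square power_mult_distrib complex_cnj_power)
    also have "\<dots> = (\<Sum>i\<in>?I. of_real (?c i) * echar (idot (?k i) t))"
      unfolding trig_sum_power2 cnj_sum sum_product sum.cartesian_product
      by (intro sum.cong refl) (auto simp: cnj_echar idot_diff_left echar_add[of _ "- _", simplified])
    finally show ?thesis by (metis Re_complex_of_real)
  qed
  then have "torus_integral (\<lambda>t. cmod (?G t) ^ 4) = (\<Sum>i\<in>?I. ?c i * of_bool (?k i = 0))"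
    using assms by (intro torus_integral_Re_trig) auto
  then show ?thesis
    unfolding L4_norm_torus_power4 weighted_energy_def sum.cartesian_product
    by (simp add: case_prod_unfold)
qed

text \<open>The left side is the pairing of \<open>F\<close> with \<open>G\<close>, hence at most
  \<open>J\<close>. Cauchy-Schwarz bounds \<open>J\<^sup>2\<close> by \<open>W * J'\<close>, and
  once more bounds \<open>J'\<^sup>2\<close> by the second moment of \<open>F\<close>, which is
  \<open>card A\<close>, times the fourth moment of \<open>G\<close>.\<close>

lemma sum_le_wiener_norm_L4_norm:
  assumes "finite A" "D \<subseteq> A"
  shows "(\<Sum>d\<in>D. g d)
       \<le> sqrt (wiener_norm A * sqrt (card A)) * L4_norm_torus (trig_sum D (\<lambda>d. of_real (g d)))"
proof -
  define F where "F = (\<lambda>t. \<Sum>a\<in>A. echar (idot a t))"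
  define G where "G = trig_sum D (\<lambda>d. of_real (g d))"
  have contF: "continuous_on UNIV F" and contG: "continuous_on UNIV G"
    unfolding F_def G_def by (intro continuous_intros)+
  have fD: "finite D" using assms finite_subset by blast
  have FF: "torus_integral (\<lambda>t. (cmod (F t))\<^sup>2) = card A"
  proof -
    have "(cmod (F t))\<^sup>2
        = Re (\<Sum>p\<in>A \<times> A. of_real 1 * echar (idot (fst p - snd p) t))" for t
    proof -
      have "complex_of_real ((cmod (F t))\<^sup>2) = (\<Sum>p\<in>A \<times> A. of_real 1 * echar (idot (fst p - snd p) t))"
        unfolding complex_norm_square F_def cnj_sum sum_product sum.cartesian_product
        by (intro sum.cong refl) (auto simp: cnj_echar idot_diff_left echar_add[of _ "- _", simplified])
      then show ?thesis by (metis Re_complex_of_real)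
    qed
    then have "torus_integral (\<lambda>t. (cmod (F t))\<^sup>2)
        = (\<Sum>p\<in>A \<times> A. 1 * of_bool (fst p - snd p = 0))"
      using assms by (intro torus_integral_Re_trig) auto
    also have "\<dots> = (\<Sum>a\<in>A. \<Sum>b\<in>A. of_bool (a = b))"
      unfolding sum.cartesian_product by (simp add: case_prod_unfold)
    also have "\<dots> = card A"
      using assms by (simp add: of_bool_def)
    finally show ?thesis .
  qed
  have FG: "torus_integral (\<lambda>t. Re (F t * cnj (G t))) = (\<Sum>d\<in>D. g d)"
  proof -
    have "F t * cnj (G t) = (\<Sum>p\<in>A \<times> D. of_real (g (snd p)) * echar (idot (fst p - snd p) t))" for t
      unfolding F_def G_def trig_sum_def cnj_sum sum_product sum.cartesian_product
      by (intro sum.cong refl) (auto simp: cnj_echar idot_diff_left echar_add[of _ "- _", simplified])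
    then have "torus_integral (\<lambda>t. Re (F t * cnj (G t)))
        = (\<Sum>p\<in>A \<times> D. g (snd p) * of_bool (fst p - snd p = 0))"
      using assms fD by (intro torus_integral_Re_trig) auto
    also have "\<dots> = (\<Sum>a\<in>A. \<Sum>d\<in>D. g d * of_bool (a = d))"
      unfolding sum.cartesian_product by (simp add: case_prod_unfold)
    also have "\<dots> = (\<Sum>d\<in>D. \<Sum>a\<in>A. g d * of_bool (a = d))"
      by (rule sum.swap)
    \<comment> \<open>Since \<open>D \<subseteq> A\<close>, every \<open>d\<close> meets exactly one
      \<open>a\<close> on the diagonal.\<close>
    also have "\<dots> = (\<Sum>d\<in>D. g d)"
      using assms by (intro sum.cong refl) (auto simp: of_bool_def if_distrib cong: if_cong)
    finally show ?thesis .
  qed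
  define W where "W = wiener_norm A"
  define L where "L = L4_norm_torus G"
  define J where "J = torus_integral (\<lambda>t. cmod (F t) * cmod (G t))"
  define J' where "J' = torus_integral (\<lambda>t. cmod (F t) * (cmod (G t))\<^sup>2)"
  have "L \<ge> 0" unfolding L_def by (rule L4_norm_torus_nonneg)
  have "W \<ge> 0" unfolding W_def wiener_norm_def by (rule torus_integral_nonneg) simp
  have J'2: "J'\<^sup>2 \<le> card A * L ^ 4"
  proof -
    have "J'\<^sup>2 \<le> torus_integral (\<lambda>t. (cmod (F t))\<^sup>2) * torus_integral (\<lambda>t. ((cmod (G t))\<^sup>2)\<^sup>2)"
      unfolding J'_def
      by (intro torus_integral_Cauchy_Schwarz continuous_intros contF contG)
    then show ?thesis
      by (simp add: FF L_def L4_norm_torus_power4 flip: power_mult)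
  qed
  have "J' \<le> sqrt (card A * L ^ 4)"
    using J'2 by (rule real_le_rsqrt)
  also have "\<dots> = sqrt (card A) * L\<^sup>2"
    using real_sqrt_pow2[of "L^2"] \<open>L \<ge> 0\<close> by (simp add: real_sqrt_mult real_sqrt_unique)
  finally have J': "J' \<le> sqrt (card A) * L\<^sup>2" .
  have "J\<^sup>2 \<le> W * J'"
  proof -
    \<comment> \<open>Giving half of the modulus of \<open>F\<close> to each factor makes its first
      moment, the Wiener norm, appear.\<close>
    have "J = torus_integral (\<lambda>t. sqrt (cmod (F t)) * (sqrt (cmod (F t)) * cmod (G t)))"
      unfolding J_def by (simp flip: mult.assoc)
    then have "J\<^sup>2 \<le> torus_integral (\<lambda>t. (sqrt (cmod (F t)))\<^sup>2)
        * torus_integral (\<lambda>t. (sqrt (cmod (F t)) * cmod (G t))\<^sup>2)"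
      by (simp only:) (intro torus_integral_Cauchy_Schwarz continuous_intros contF contG)
    then show ?thesis
      by (simp add: power_mult_distrib W_def wiener_norm_def J'_def F_def)
  qed
  also have "\<dots> \<le> W * (sqrt (card A) * L\<^sup>2)"
    using J' \<open>W \<ge> 0\<close> by (rule mult_left_mono)
  finally have "J \<le> sqrt (W * (sqrt (card A) * L\<^sup>2))"
    by (rule real_le_rsqrt)
  also have "\<dots> = sqrt (W * sqrt (card A)) * L"
    using \<open>L \<ge> 0\<close> by (simp add: real_sqrt_mult)
  finally have "J \<le> sqrt (W * sqrt (card A)) * L" .
  moreover have "(\<Sum>d\<in>D. g d) \<le> J"
    unfolding FG[symmetric] J_def
  proof (rule torus_integral_mono)
    show "Re (F t * cnj (G t)) \<le> cmod (F t) * cmod (G t)" for t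
      by (metis complex_Re_le_cmod complex_mod_cnj norm_mult)
  qed (intro continuous_intros contF contG)+
  ultimately show ?thesis by (simp add: W_def L_def G_def)
qed

section \<open>Near-minimal measures and the capacity bound\<close>

text \<open>A measure with energy close to the infimum suffices; the slack \<delta> replaces an
  argument that the infimum is attained.\<close>

lemma sqrt_additive_capacity_approx:
  fixes X :: "'a::plus set"
  assumes "X \<noteq> {}" and "\<delta> > 1"
  obtains \<mu> where "set_pmf \<mu> \<subseteq> X"
    and "sqrt (additive_capacity X) \<le> \<delta> * inverse (sqrt (additive_energy \<mu>))"
proof -
  define M where "M = {\<mu>. set_pmf \<mu> \<subseteq> X}"
  define I where "I = (INF \<mu>\<in>M. additive_energy \<mu>)"
  have cap: "additive_capacity X = inverse I"
    by (simp add: additive_capacity_def I_def M_def)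
  obtain x where "x \<in> X" using assms by blast
  then have M: "return_pmf x \<in> M" by (simp add: M_def)
  have bdd: "bdd_below (additive_energy ` M)"
    by (rule bdd_belowI2[where m = 0]) (rule additive_energy_nonneg)
  have "I \<ge> 0" unfolding I_def using M by (intro cINF_greatest) (auto intro: additive_energy_nonneg)
  show thesis
  proof (cases "I = 0") \<comment> \<open>\<open>I = 0\<close> does not occur for finite \<open>X\<close>; the junk value \<open>inverse 0 = 0\<close> settles it anyway\<close>
    case True
    show thesis
      by (rule that[of "return_pmf x"])
        (use \<open>x \<in> X\<close> \<open>\<delta> > 1\<close> in \<open>auto simp: cap True intro!: mult_nonneg_nonneg additive_energy_nonneg\<close>)
  next
    case False
    with \<open>I \<ge> 0\<close> have "I > 0" by simp
    \<comment> \<open>The slack in the energy is squared, since the capacity enters through its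
      square root.\<close>
    have "1 < \<delta>\<^sup>2" using \<open>\<delta> > 1\<close> by (simp add: one_less_power)
    with \<open>I > 0\<close> have "I < \<delta>\<^sup>2 * I" by simp
    then obtain \<mu> where \<mu>: "\<mu> \<in> M" "additive_energy \<mu> < \<delta>\<^sup>2 * I"
      using M bdd unfolding I_def by (subst (asm) cINF_less_iff) auto
    have "I \<le> additive_energy \<mu>"
      unfolding I_def using bdd \<mu>(1) by (rule cINF_lower)
    with \<open>I > 0\<close> have pos: "additive_energy \<mu> > 0" by simp
    have "sqrt (additive_energy \<mu>) \<le> sqrt (\<delta>\<^sup>2 * I)"
      using \<mu>(2) by simp
    also have "\<dots> = \<delta> * sqrt I"
      using \<open>\<delta> > 1\<close> by (simp add: real_sqrt_mult)
    finally have "sqrt (additive_capacity X) \<le> \<delta> * inverse (sqrt (additive_energy \<mu>))"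
      using pos \<open>I > 0\<close> by (simp add: cap real_sqrt_inverse real_sqrt_divide field_simps)
    with \<mu>(1) show thesis by (intro that[of \<mu>]) (auto simp: M_def)
  qed
qed

text \<open>The main estimate for arbitrary measures on the pieces. Both sides of the duality bound
  are expressed through \<open>T\<close>: decoupling gives
  \<open>T \<le> sqrt B * (K * sqrt T)\<close>, and squaring lets one factor \<open>T\<close>
  cancel.\<close>

lemma sum_inverse_sqrt_energy_le:
  fixes A D :: "(int ^ 'm) set"
    and S :: "(int ^ 'd) set"
  assumes A: "finite A" "D \<subseteq> A"
    and frei: "freiman2_isomorphic D S"
    and S: "S = (\<Union>\<theta>\<in>\<Theta>. P \<theta>)" and disj: "disjoint_family_on P \<Theta>" and fin: "finite \<Theta>"
    and dec: "L4_decoupling S \<Theta> P K"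
    and \<mu>: "\<And>\<theta>. \<theta> \<in> \<Theta> \<Longrightarrow> set_pmf (\<mu> \<theta>) \<subseteq> P \<theta>"
  shows "(\<Sum>\<theta>\<in>\<Theta>. inverse (sqrt (additive_energy (\<mu> \<theta>))))
       \<le> K\<^sup>2 * sqrt (real (card A)) * wiener_norm A"
proof -
  obtain \<phi> where bij: "bij_betw \<phi> D S" and iso: "\<And>d1 d2 d3 d4. d1 \<in> D \<Longrightarrow> d2 \<in> D \<Longrightarrow> d3 \<in> D \<Longrightarrow> d4 \<in> D \<Longrightarrow>
           d1 + d2 = d3 + d4 \<longleftrightarrow> \<phi> d1 + \<phi> d2 = \<phi> d3 + \<phi> d4"
    using frei unfolding freiman2_isomorphic_def by blast
  have fD: "finite D" using A finite_subset by blast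
  have fS: "finite S" using bij fD bij_betw_finite by blast
  have PS: "P \<theta> \<subseteq> S" and fP: "finite (P \<theta>)" if "\<theta> \<in> \<Theta>" for \<theta>
    using that S finite_subset[OF _ fS, of "P \<theta>"] by blast+
  define c where "c = (\<lambda>\<theta>. inverse (sqrt (additive_energy (\<mu> \<theta>))))"
  define w where "w = (\<lambda>x. \<Sum>\<theta>\<in>\<Theta>. c \<theta> * pmf (\<mu> \<theta>) x)"
  define B where "B = wiener_norm A * sqrt (card A)"
  define T where "T = (\<Sum>\<theta>\<in>\<Theta>. c \<theta>)"
  have c0: "c \<theta> \<ge> 0" for \<theta> by (simp add: c_def additive_energy_nonneg)
  then have "T \<ge> 0" unfolding T_def by (intro sum_nonneg)
  have "B \<ge> 0" unfolding B_def wiener_norm_def by (auto intro!: mult_nonneg_nonneg torus_integral_nonneg)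
  \<comment> \<open>Disjointness of the pieces: on \<open>P \<theta>\<close> the other measures have
    no mass.\<close>
  have w_P: "w x = c \<theta> * pmf (\<mu> \<theta>) x" if "\<theta> \<in> \<Theta>" "x \<in> P \<theta>" for \<theta> x
  proof -
    have zero: "c \<eta> * pmf (\<mu> \<eta>) x = 0" if "\<eta> \<in> \<Theta> - {\<theta>}" for \<eta>
    proof -
      have "P \<eta> \<inter> P \<theta> = {}"
        using disj that \<open>\<theta> \<in> \<Theta>\<close> by (auto simp: disjoint_family_on_def)
      then have "x \<notin> set_pmf (\<mu> \<eta>)"
        using \<mu>[of \<eta>] that \<open>x \<in> P \<theta>\<close> by blast
      then show ?thesis by (simp add: pmf_eq_0_set_pmf)
    qed
    have "w x = (\<Sum>\<eta>\<in>{\<theta>}. c \<eta> * pmf (\<mu> \<eta>) x)"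
      unfolding w_def using fin \<open>\<theta> \<in> \<Theta>\<close> zero by (intro sum.mono_neutral_right) auto
    then show ?thesis by simp
  qed
  have "T = (\<Sum>\<theta>\<in>\<Theta>. c \<theta> * (\<Sum>x\<in>S. pmf (\<mu> \<theta>) x))"
    unfolding T_def
  proof (rule sum.cong)
    fix \<theta> assume "\<theta> \<in> \<Theta>"
    then have "set_pmf (\<mu> \<theta>) \<subseteq> S" using \<mu> PS by blast
    then show "c \<theta> = c \<theta> * (\<Sum>x\<in>S. pmf (\<mu> \<theta>) x)"
      using fS by (simp add: sum_pmf_eq_1)
  qed simp
  also have "\<dots> = (\<Sum>x\<in>S. w x)"
    unfolding w_def sum_distrib_left by (rule sum.swap)
  also have "\<dots> = (\<Sum>d\<in>D. w (\<phi> d))"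
    by (rule sum.reindex_bij_betw[OF bij, symmetric])
  also have "\<dots> \<le> sqrt B * L4_norm_torus (trig_sum D (\<lambda>d. of_real (w (\<phi> d))))"
    unfolding B_def by (rule sum_le_wiener_norm_L4_norm[OF A])
  finally have T_le: "T \<le> sqrt B * L4_norm_torus (trig_sum D (\<lambda>d. of_real (w (\<phi> d))))" .
  \<comment> \<open>Both fourth powers are energies, and these agree under the Freiman
    isomorphism.\<close>
  have "L4_norm_torus (trig_sum D (\<lambda>d. of_real (w (\<phi> d)))) = L4_norm_torus (trig_sum S (\<lambda>x. of_real (w x)))"
  proof (rule power_eq_imp_eq_base[where n = 4])
    show "L4_norm_torus (trig_sum D (\<lambda>d. of_real (w (\<phi> d)))) ^ 4 = L4_norm_torus (trig_sum S (\<lambda>x. of_real (w x))) ^ 4"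
      using weighted_energy_freiman2_isomorphism[OF bij iso] by (simp add: L4_norm_trig_sum_power4 fD fS)
  qed (auto simp: L4_norm_torus_nonneg)
  also have "L4_norm_torus (trig_sum S (\<lambda>x. of_real (w x)))
      \<le> K * sqrt (\<Sum>\<theta>\<in>\<Theta>. (L4_norm_torus (trig_sum (P \<theta>) (\<lambda>x. of_real (w x))))\<^sup>2)"
    using dec unfolding L4_decoupling_def by blast
  finally have L_le: "L4_norm_torus (trig_sum D (\<lambda>d. of_real (w (\<phi> d))))
      \<le> K * sqrt (\<Sum>\<theta>\<in>\<Theta>. (L4_norm_torus (trig_sum (P \<theta>) (\<lambda>x. of_real (w x))))\<^sup>2)" .
  \<comment> \<open>On one piece \<open>L ^ 4 = c \<theta> ^ 4 * E\<close>, and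
    \<open>(c \<theta>)\<^sup>2 * E = 1\<close> when \<open>E \<noteq> 0\<close>, so
    \<open>L\<^sup>2 = c \<theta>\<close>. If \<open>E = 0\<close>, then
    \<open>c \<theta> = inverse 0 = 0\<close> and both sides vanish.\<close>
  have pieces: "(\<Sum>\<theta>\<in>\<Theta>. (L4_norm_torus (trig_sum (P \<theta>) (\<lambda>x. of_real (w x))))\<^sup>2) = T"
    unfolding T_def
  proof (rule sum.cong)
    fix \<theta> assume \<theta>: "\<theta> \<in> \<Theta>"
    define E where "E = additive_energy (\<mu> \<theta>)"
    define L where "L = L4_norm_torus (trig_sum (P \<theta>) (\<lambda>x. of_real (w x)))"
    have c_E: "c \<theta> = inverse (sqrt E)" by (simp add: c_def E_def)
    have "E \<ge> 0" by (simp add: E_def additive_energy_nonneg)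
    have "(L\<^sup>2)\<^sup>2 = L ^ 4" by (simp flip: power_mult)
    also have "\<dots> = weighted_energy (P \<theta>) w"
      unfolding L_def using fP[OF \<theta>] by (rule L4_norm_trig_sum_power4)
    also have "\<dots> = weighted_energy (P \<theta>) (\<lambda>x. c \<theta> * pmf (\<mu> \<theta>) x)"
      using w_P[OF \<theta>] by (rule weighted_energy_cong)
    also have "\<dots> = c \<theta> ^ 4 * E"
      by (simp add: weighted_energy_scale E_def additive_energy_eq_weighted_energy[OF fP \<mu>] \<theta>)
    also have "\<dots> = (c \<theta>)\<^sup>2"
    proof (cases "E = 0")
      case False
      then have "(c \<theta>)\<^sup>2 * E = 1" using \<open>E \<ge> 0\<close> by (simp add: c_E power_inverse)
      then show ?thesis by (simp add: power4_eq_xxxx power2_eq_square mult.assoc)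
    qed (simp add: c_E)
    finally have "(L\<^sup>2)\<^sup>2 = (c \<theta>)\<^sup>2" .
    then show "L\<^sup>2 = c \<theta>"
      by (rule power_eq_imp_eq_base) (auto simp: c0)
  qed simp
  have "T \<le> sqrt B * (K * sqrt T)"
    using T_le mult_left_mono[OF L_le[unfolded pieces], of "sqrt B"] \<open>B \<ge> 0\<close> by simp
  then have "T\<^sup>2 \<le> (sqrt B * (K * sqrt T))\<^sup>2"
    using \<open>T \<ge> 0\<close> by (rule power_mono)
  also have "\<dots> = K\<^sup>2 * B * T"
    using \<open>B \<ge> 0\<close> \<open>T \<ge> 0\<close> by (simp add: power_mult_distrib)
  finally have "T * T \<le> K\<^sup>2 * B * T" by (simp add: power2_eq_square)
  then have "T \<le> K\<^sup>2 * B"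
    \<comment> \<open>For \<open>T = 0\<close> there is nothing to cancel, but the right side is
      nonnegative.\<close>
    using \<open>T \<ge> 0\<close> \<open>B \<ge> 0\<close> by (cases "T = 0") (auto simp: mult_le_cancel_right)
  then show ?thesis by (simp add: T_def c_def B_def mult_ac)
qed

theorem theorem12:
  fixes A D :: "(int ^ 'm) set"
    and S :: "(int ^ 'd) set"
    and \<Theta> :: "'i set"
    and P :: "'i \<Rightarrow> (int ^ 'd) set"
    and K :: real
  assumes "finite A"
    and "D \<subseteq> A"
    and "freiman2_isomorphic D S"
    and "S = (\<Union>\<theta>\<in>\<Theta>. P \<theta>)"
    and "disjoint_family_on P \<Theta>"
    and "\<And>\<theta>. \<theta> \<in> \<Theta> \<Longrightarrow> P \<theta> \<noteq> {}"
    and "L4_decoupling S \<Theta> P K"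
  shows "(\<Sum>\<theta>\<in>\<Theta>. sqrt (additive_capacity (P \<theta>)))
           \<le> K\<^sup>2 * sqrt (real (card A)) * wiener_norm A"
proof (cases "finite \<Theta>")
  case fin: True
  let ?R = "K\<^sup>2 * sqrt (real (card A)) * wiener_norm A"
  have bound: "(\<Sum>\<theta>\<in>\<Theta>. sqrt (additive_capacity (P \<theta>))) \<le> \<delta> * ?R" if "\<delta> > 1" for \<delta>
  proof -
    have "\<exists>\<mu>. set_pmf \<mu> \<subseteq> P \<theta> \<and>
        sqrt (additive_capacity (P \<theta>)) \<le> \<delta> * inverse (sqrt (additive_energy \<mu>))" if "\<theta> \<in> \<Theta>" for \<theta>
      using sqrt_additive_capacity_approx[OF assms(6)[OF that] \<open>\<delta> > 1\<close>] by metis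
    then obtain \<mu> where \<mu>: "\<And>\<theta>. \<theta> \<in> \<Theta> \<Longrightarrow> set_pmf (\<mu> \<theta>) \<subseteq> P \<theta>"
      and cap: "\<And>\<theta>. \<theta> \<in> \<Theta> \<Longrightarrow>
        sqrt (additive_capacity (P \<theta>)) \<le> \<delta> * inverse (sqrt (additive_energy (\<mu> \<theta>)))"
      by metis
    have "(\<Sum>\<theta>\<in>\<Theta>. sqrt (additive_capacity (P \<theta>)))
        \<le> \<delta> * (\<Sum>\<theta>\<in>\<Theta>. inverse (sqrt (additive_energy (\<mu> \<theta>))))"
      unfolding sum_distrib_left by (intro sum_mono cap)
    also have "\<dots> \<le> \<delta> * ?R"
      using sum_inverse_sqrt_energy_le[OF assms(1-5) fin assms(7) \<mu>] that
      by (intro mult_left_mono) auto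
    finally show ?thesis .
  qed
  \<comment> \<open>The right side \<open>?R\<close> is independent of \<delta> and of the chosen
    measures, so \<delta> may tend to 1 from above.\<close>
  have "((\<lambda>\<delta>. \<delta> * ?R) \<longlongrightarrow> 1 * ?R) (at_right 1)"
    by (intro tendsto_intros)
  moreover have "\<forall>\<^sub>F \<delta> in at_right 1. (\<Sum>\<theta>\<in>\<Theta>. sqrt (additive_capacity (P \<theta>))) \<le> \<delta> * ?R"
    using bound by (intro eventually_at_right_less[THEN eventually_mono]) auto
  ultimately have "(\<Sum>\<theta>\<in>\<Theta>. sqrt (additive_capacity (P \<theta>))) \<le> 1 * ?R"
    by (rule tendsto_lowerbound) simp
  then show ?thesis by simp
next
  \<comment> \<open>A sum over an infinite index set is 0 by convention, and the right side is
    nonnegative.\<close>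
  case False
  then show ?thesis
    by (simp add: wiener_norm_def torus_integral_nonneg)
qed

end
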